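(* Let $k\ge 1$ and $n\ge 10k^3$ be integers. There exists a generic point set $S\subset\mathbb{R}^2$ with $|S|=n$ such that every subset $P\subseteq S$ that is a $k$-modal path satisfies $$|P| \ \le\ \Bigl\lceil \sqrt{(2k+1)\bigl(|S|-\tfrac14\bigr)} - \tfrac{k}{2} \Bigr\rceil + 1 .$$
   Context: For $p=(a,b)\in\mathbb{R}^2$ write $x(p)=a$, $y(p)=b$. A finite set $S\subset\mathbb{R}^2$ is generic if $x(p)\ne x(q)$ and $y(p)\neq y(q)$ for all distinct $p,q\in S$. A finite set of points is an increasing path if any two distinct points $p,q$ of it with $x(p)\le x(q)$ satisfy $x(p)<x(q)$ and $y(p)<y(q)$; it is a decreasing path if any two distinct points $p,q$ of it with $x(p)\le x(q)$ satisfy $x(p)<x(q)$ and $y(p)>y(q)$ (so the empty set and one-point sets are both). A $(k+1)$-partition of a finite set $S$ is a tuple $(S_0,\dots,S_k)$ of possibly empty sets with $S=S_0\cup\dots\cup S_k$ and $\max_{p\in S_i}x(p)<\min_{q\in S_j}x(q)$ whenever $0\le i<j\le k$ (with $\max_\varnothing=-\infty$, $\min_\varnothing=+\infty$). A generic set $P$ is a $k$-modal path if it admits a $(k+1)$-partition $(P_0,\dots,P_k)$ such that either all $P_i$ with $i$ even are increasing paths and all $P_i$ with $i$ odd are decreasing paths, or all $P_i$ with $i$ even are decreasing paths and all $P_i$ with $i$ odd are increasing paths. Its length is $|P|$. *)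

theory Defs
  imports Complex_Main "HOL-Library.Extended_Real"
begin

type_synonym point = "real \<times> real"

definition generic :: "point set \<Rightarrow> bool" where
  "generic S \<longleftrightarrow> finite S \<and>
     (\<forall>p\<in>S. \<forall>q\<in>S. p \<noteq> q \<longrightarrow> fst p \<noteq> fst q \<and> snd p \<noteq> snd q)"

definition increasing_path :: "point set \<Rightarrow> bool" where
  "increasing_path P \<longleftrightarrow> finite P \<and>
     (\<forall>p\<in>P. \<forall>q\<in>P. p \<noteq> q \<and> fst p \<le> fst q \<longrightarrow> fst p < fst q \<and> snd p < snd q)"

definition decreasing_path :: "point set \<Rightarrow> bool" where
  "decreasing_path P \<longleftrightarrow> finite P \<and>
     (\<forall>p\<in>P. \<forall>q\<in>P. p \<noteq> q \<and> fst p \<le> fst q \<longrightarrow> fst p < fst q \<and> snd p > snd q)"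

text \<open>
  A tuple \<open>(Q 0, \<dots>, Q k)\<close> is a function on the naturals of which only the values
  at indices \<open>0, \<dots>, k\<close> matter, so \<open>k\<close> here stands for a \<open>(k + 1)\<close>-partition.
  Suprema and infima are taken in the extended reals: on finite nonempty sets they are the
  maximum and the minimum, and on the empty set they are \<open>-\<infinity>\<close> and
  \<open>\<infinity>\<close>, respectively.
\<close>

definition x_partition :: "nat \<Rightarrow> point set \<Rightarrow> (nat \<Rightarrow> point set) \<Rightarrow> bool" where
  "x_partition k S Q \<longleftrightarrow> finite S \<and> S = (\<Union>i\<le>k. Q i) \<and>
     (\<forall>i j. i < j \<and> j \<le> k \<longrightarrow>
        (SUP p\<in>Q i. ereal (fst p)) < (INF q\<in>Q j. ereal (fst q)))"

definition modal_path :: "nat \<Rightarrow> point set \<Rightarrow> bool" where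
  "modal_path k P \<longleftrightarrow> generic P \<and>
     (\<exists>Q. x_partition k P Q \<and>
        ((\<forall>i\<le>k. if even i then increasing_path (Q i) else decreasing_path (Q i)) \<or>
         (\<forall>i\<le>k. if even i then decreasing_path (Q i) else increasing_path (Q i))))"

lemma SUP_less_INF_iff:
  assumes "finite A" and "finite B"
  shows "(SUP p\<in>A. ereal (fst p)) < (INF q\<in>B. ereal (fst q)) \<longleftrightarrow>
    (\<forall>p\<in>A. \<forall>q\<in>B. fst p < fst q)"
proof
  assume less: "(SUP p\<in>A. ereal (fst p)) < (INF q\<in>B. ereal (fst q))"
  show "\<forall>p\<in>A. \<forall>q\<in>B. fst p < fst q"
  proof (intro ballI)
    fix p q assume "p \<in> A" "q \<in> B"
    then have "ereal (fst p) \<le> (SUP p\<in>A. ereal (fst p))"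
      and "(INF q\<in>B. ereal (fst q)) \<le> ereal (fst q)"
      by (auto intro: SUP_upper INF_lower)
    with less have "ereal (fst p) < ereal (fst q)"
      by (meson le_less_trans less_le_trans)
    then show "fst p < fst q" by simp
  qed
next
  assume all: "\<forall>p\<in>A. \<forall>q\<in>B. fst p < fst q"
  have A: "(SUP p\<in>A. ereal (fst p)) \<in> (\<lambda>p. ereal (fst p)) ` A" if "A \<noteq> {}"
    using that assms(1) by (metis Max_Sup Max_in finite_imageI image_is_empty)
  have B: "(INF q\<in>B. ereal (fst q)) \<in> (\<lambda>q. ereal (fst q)) ` B" if "B \<noteq> {}"
    using that assms(2) by (metis Min_Inf Min_in finite_imageI image_is_empty)
  show "(SUP p\<in>A. ereal (fst p)) < (INF q\<in>B. ereal (fst q))"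
  proof (cases "A = {} \<or> B = {}")
    case True
    then show ?thesis
      using A B by (cases "A = {}"; cases "B = {}") (auto simp: bot_ereal_def top_ereal_def)
  next
    case False
    then obtain p q where "p \<in> A" "(SUP p\<in>A. ereal (fst p)) = ereal (fst p)"
      "q \<in> B" "(INF q\<in>B. ereal (fst q)) = ereal (fst q)"
      using A B by (auto simp: image_iff)
    then show ?thesis using all by simp
  qed
qed

end

theory Submission
  imports Defs
begin

text \<open>
  Embed lattice points \<open>(i, j)\<close> by the slightly rotated map
  \<open>(i, j) \<mapsto> (K i + j, K j - i)\<close>. Then \<open>j\<close> increases strictly along increasing
  paths while \<open>i\<close> does not decrease, and \<open>i\<close> increases strictly along decreasing paths.
  Take the hexagon \<open>0 \<le> i < W\<close>, \<open>0 \<le> j \<le> 2 m\<close>, \<open>m \<le> i + j < W + m\<close>, and label a point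
  of the \<open>s\<close>-th piece of a modal path by \<open>i + j - m + s m\<close> if the piece is increasing and by
  \<open>i + s m\<close> if it is decreasing. This label increases strictly along the whole path and lies
  below \<open>W + k m\<close>, which therefore bounds the length. For fixed \<open>N = W + k m\<close> the hexagon has
  \<open>W (2 m + 1) - m (m + 1)\<close> points; over real \<open>m\<close> the maximum is
  \<open>(N + k / 2)\<^sup>2 / (2 k + 1) + 1 / 4\<close>, and rounding \<open>m\<close> to an integer costs at most one unit
  of \<open>N\<close>.
\<close>

definition hexagon :: "nat \<Rightarrow> nat \<Rightarrow> (nat \<times> nat) set" where
  "hexagon W m = {(i, j). i < W \<and> j \<le> 2 * m \<and> m \<le> i + j \<and> i + j < W + m}"

definition rotate_embed :: "nat \<Rightarrow> nat \<times> nat \<Rightarrow> point" where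
  "rotate_embed K = (\<lambda>(i, j). (real (i * K + j), real (j * K) - real i))"

section \<open>Number of lattice points of the hexagon\<close>

lemma sum_dist_center:
  "(\<Sum>j\<le>2 * m. \<bar>int m - int j\<bar>) = int m * (int m + 1)"
proof (induction m)
  case (Suc m)
  have "(\<Sum>j\<le>2 * Suc m. \<bar>int (Suc m) - int j\<bar>) =
      (\<Sum>j\<le>Suc (Suc (2 * m)). \<bar>int (Suc m) - int j\<bar>)"
    by simp
  also have "\<dots> = int (Suc m) + (\<Sum>j\<le>Suc (2 * m). \<bar>int m - int j\<bar>)"
    by (subst sum.atMost_Suc_shift) simp
  also have "\<dots> = int (Suc m) * (int (Suc m) + 1)"
    using Suc by (simp add: algebra_simps)
  finally show ?case .
qed simp

lemma card_hexagon:
  assumes "m \<le> W"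
  shows "int (card (hexagon W m)) = int W * (2 * int m + 1) - int m * (int m + 1)"
proof -
  \<comment> \<open>Slice by rows of constant \<open>j\<close>. The truncated \<open>m - j\<close>
    is the left end of a row, so row \<open>j\<close> has W - |m - j| points;
    \<open>m \<le> W\<close> keeps this nonnegative.\<close>
  have "hexagon W m = prod.swap ` (SIGMA j:{..2 * m}. {m - j..<min W (W + m - j)})"
    by (force simp: hexagon_def image_iff)
  then have "card (hexagon W m) = (\<Sum>j\<le>2 * m. min W (W + m - j) - (m - j))"
    by (simp add: card_image)
  then have "int (card (hexagon W m)) = (\<Sum>j\<le>2 * m. int W - \<bar>int m - int j\<bar>)"
    using assms by (simp only: of_nat_sum) (intro sum.cong, auto)
  then show ?thesis
    by (simp add: sum_subtractf sum_dist_center)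
qed

lemma finite_hexagon: "finite (hexagon W m)"
  by (rule finite_subset[of _ "{..<W} \<times> {..2 * m}"]) (auto simp: hexagon_def)

section \<open>Coordinate orders of the embedded points\<close>

text \<open>These are two-digit numbers in base \<open>K\<close>. Hence both coordinates of an
  embedded point compare lexicographically, with ties in the leading index broken by the other
  one.\<close>

lemma lex_less:
  fixes a b c d K :: nat
  assumes "b < K" "d < K"
  shows "a * K + b < c * K + d \<longleftrightarrow> a < c \<or> a = c \<and> b < d"
proof -
  have "a * K + b < c * K + d" if "a < c" "b < K" for a b c d :: nat
  proof -
    have "Suc a * K \<le> c * K" using that by (intro mult_le_mono1) simp
    then show ?thesis using that by simp
  qed
  from this[of a c b d] this[of c a d b] show ?thesis
    using assms by (cases a c rule: linorder_cases) auto
qed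

lemma fst_rotate_embed_less_iff:
  assumes "snd p < K" "snd q < K"
  shows "fst (rotate_embed K p) < fst (rotate_embed K q) \<longleftrightarrow>
    fst p < fst q \<or> fst p = fst q \<and> snd p < snd q"
  using lex_less[OF assms, of "fst p" "fst q"]
  by (simp add: rotate_embed_def case_prod_beta del: of_nat_add of_nat_mult)

lemma snd_rotate_embed_less_iff:
  assumes "fst p < K" "fst q < K"
  shows "snd (rotate_embed K p) < snd (rotate_embed K q) \<longleftrightarrow>
    snd p < snd q \<or> snd p = snd q \<and> fst q < fst p"
proof -
  \<comment> \<open>Moving each subtracted index to the other side gives base-\<open>K\<close>
    numbers again, which is why the tie-break is reversed.\<close>
  have "snd (rotate_embed K p) < snd (rotate_embed K q) \<longleftrightarrow>
      real (snd p * K + fst q) < real (snd q * K + fst p)"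
    by (auto simp: rotate_embed_def case_prod_beta)
  then show ?thesis
    using lex_less[of "fst q" K "fst p" "snd p" "snd q"] assms by (simp del: of_nat_add of_nat_mult)
qed

section \<open>Length of modal paths in the hexagon\<close>

text \<open>The ordering hypothesis on \<open>(i, j)\<close> and \<open>(i', j')\<close> is the order of the embedded points
  by abscissa.\<close>

lemma label_less_across_pieces:
  fixes i j i' j' m a b :: nat
  assumes "(i, j) \<in> hexagon W m" "(i', j') \<in> hexagon W m"
    and "i < i' \<or> i = i' \<and> j < j'" and "a < b"
  shows "(if even a = e then i + j - m else i) + a * m <
    (if even b = e then i' + j' - m else i') + b * m"
proof -
  have b1: "a * m + m \<le> b * m"
    using mult_le_mono1[of "Suc a" b m] assms(4) by simp
  \<comment> \<open>Between pieces of opposite kind an offset of \<open>m\<close> suffices. Between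
    two increasing pieces \<open>j\<close> can drop by up to \<open>2 * m\<close>, but equal parity
    puts them at least two indices apart.\<close>
  have b2: "a * m + 2 * m \<le> b * m" if "even a = even b"
  proof -
    have "a + 2 \<le> b" using that assms(4) by presburger
    from mult_le_mono1[OF this, of m] show ?thesis by (simp add: algebra_simps)
  qed
  show ?thesis
    using assms b1 b2 by (auto simp: hexagon_def split: if_splits)
qed

lemma card_modal_path_le:
  assumes PS: "P \<subseteq> rotate_embed K ` hexagon W m" and K: "W \<le> K" "2 * m < K"
    and "modal_path k P"
  shows "card P \<le> W + k * m"
proof -
  \<comment> \<open>The Boolean \<open>e\<close> tells which parity carries the increasing pieces,
    so both alternations are treated at once.\<close>
  from assms(4) obtain Q e where gen: "generic P" and part: "x_partition k P Q"
    and mono: "\<And>s. s \<le> k \<Longrightarrow>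
      (if even s = e then increasing_path (Q s) else decreasing_path (Q s))"
    unfolding modal_path_def by (metis (full_types))
  have finP: "finite P" and PU: "P = (\<Union>s\<le>k. Q s)"
    using part by (auto simp: x_partition_def)
  have Qfin: "finite (Q s)" if "s \<le> k" for s
    using finite_subset[OF _ finP, of "Q s"] that by (auto simp: PU)
  have sep: "fst p < fst q" if "s < t" "t \<le> k" "p \<in> Q s" "q \<in> Q t" for p q s t
    using that part SUP_less_INF_iff[OF Qfin Qfin, of s t] by (auto simp: x_partition_def)
  from PU have "\<forall>p\<in>P. \<exists>s\<le>k. p \<in> Q s" by auto
  then obtain piece where piece: "\<And>p. p \<in> P \<Longrightarrow> piece p \<le> k \<and> p \<in> Q (piece p)"
    by metis
  from PS have "\<forall>p\<in>P. \<exists>v\<in>hexagon W m. p = rotate_embed K v" by blast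
  then obtain v where v: "\<And>p. p \<in> P \<Longrightarrow> v p \<in> hexagon W m \<and> p = rotate_embed K (v p)"
    by metis
  define label where "label p =
    (if even (piece p) = e then fst (v p) + snd (v p) - m else fst (v p)) + piece p * m" for p
  have less: "label p < label q" if p: "p \<in> P" and q: "q \<in> P" and pq: "fst p < fst q" for p q
  proof -
    obtain i j where ij: "v p = (i, j)" by fastforce
    obtain i' j' where ij': "v q = (i', j')" by fastforce
    have hex: "(i, j) \<in> hexagon W m" "(i', j') \<in> hexagon W m"
      using v[OF p] v[OF q] ij ij' by auto
    have emb: "p = rotate_embed K (i, j)" "q = rotate_embed K (i', j')"
      using v[OF p] v[OF q] ij ij' by auto
    have bd: "i < K" "j < K" "i' < K" "j' < K"
      using hex K by (auto simp: hexagon_def)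
    have x: "i < i' \<or> i = i' \<and> j < j'"
      using pq fst_rotate_embed_less_iff[of "(i, j)" K "(i', j')"] emb bd by simp
    have "piece p \<le> piece q"
      using sep[of "piece q" "piece p" q p] piece[OF p] piece[OF q] pq by force
    then consider "piece p < piece q" | "piece p = piece q" by linarith
    then show ?thesis
    proof cases
      case 1
      then show ?thesis
        using label_less_across_pieces[OF hex x, of "piece p" "piece q" e]
        by (simp only: label_def ij ij' fst_conv snd_conv)
    next
      case 2
      have Q: "p \<in> Q (piece p)" "q \<in> Q (piece p)" "piece p \<le> k" "p \<noteq> q"
        using piece[OF p] piece[OF q] 2 pq by auto
      show ?thesis
      proof (cases "even (piece p) = e")
        case True
        then have "snd p < snd q"
          using mono[OF Q(3)] Q pq by (auto simp: increasing_path_def)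
        \<comment> \<open>Together with \<open>x\<close> this leaves only \<open>j < j'\<close> and
          \<open>i \<le> i'\<close>. Since \<open>m \<le> i + j\<close> in the hexagon, the
          truncated subtraction in \<open>label\<close> is exact.\<close>
        then have "j < j' \<or> j = j' \<and> i' < i"
          using snd_rotate_embed_less_iff[of "(i, j)" K "(i', j')"] emb bd by simp
        then show ?thesis
          using True x hex 2 by (auto simp: label_def ij ij' hexagon_def)
      next
        case False
        then have "snd q < snd p"
          using mono[OF Q(3)] Q pq by (auto simp: decreasing_path_def)
        \<comment> \<open>Here \<open>i = i'\<close> would contradict \<open>x\<close>, so
          \<open>i < i'\<close> remains.\<close>
        then have "j' < j \<or> j' = j \<and> i < i'"
          using snd_rotate_embed_less_iff[of "(i', j')" K "(i, j)"] emb bd by simp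
        then show ?thesis
          using False x 2 by (auto simp: label_def ij ij')
      qed
    qed
  qed
  have "inj_on label P"
  proof (rule inj_onI)
    fix p q assume pq: "p \<in> P" "q \<in> P" "label p = label q"
    show "p = q"
    proof (rule ccontr)
      assume "p \<noteq> q"
      with gen pq have "fst p < fst q \<or> fst q < fst p"
        unfolding generic_def by (metis linorder_neqE)
      with less pq show False by fastforce
    qed
  qed
  moreover have "label ` P \<subseteq> {..<W + k * m}"
  proof
    fix l assume "l \<in> label ` P"
    then obtain p where p: "p \<in> P" "l = label p" by blast
    have "piece p * m \<le> k * m" using piece[OF p(1)] by (intro mult_le_mono1) simp
    moreover have "(if even (piece p) = e then fst (v p) + snd (v p) - m else fst (v p)) < W"
      using v[OF p(1)] by (auto simp: hexagon_def)
    ultimately show "l \<in> {..<W + k * m}"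
      by (simp only: p(2) label_def lessThan_iff add_less_le_mono)
  qed
  ultimately have "card P \<le> card {..<W + k * m}"
    by (intro card_inj_on_le) auto
  then show ?thesis by simp
qed

text \<open>Genericity of the image needs injectivity in each coordinate separately.\<close>

lemma inj_on_rotate_embed:
  assumes "W \<le> K" "2 * m < K"
  shows "inj_on (fst \<circ> rotate_embed K) (hexagon W m)"
    and "inj_on (snd \<circ> rotate_embed K) (hexagon W m)"
proof -
  have bd: "fst p < K \<and> snd p < K" if "p \<in> hexagon W m" for p
    using that assms by (auto simp: hexagon_def)
  show "inj_on (fst \<circ> rotate_embed K) (hexagon W m)"
  proof (rule inj_onI)
    fix p q assume "p \<in> hexagon W m" "q \<in> hexagon W m"
      and eq: "(fst \<circ> rotate_embed K) p = (fst \<circ> rotate_embed K) q"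
    then show "p = q"
      using fst_rotate_embed_less_iff[of p K q] fst_rotate_embed_less_iff[of q K p] bd
      by (auto simp: prod_eq_iff)
  qed
  show "inj_on (snd \<circ> rotate_embed K) (hexagon W m)"
  proof (rule inj_onI)
    fix p q assume "p \<in> hexagon W m" "q \<in> hexagon W m"
      and eq: "(snd \<circ> rotate_embed K) p = (snd \<circ> rotate_embed K) q"
    then show "p = q"
      using snd_rotate_embed_less_iff[of p K q] snd_rotate_embed_less_iff[of q K p] bd
      by (auto simp: prod_eq_iff)
  qed
qed

section \<open>Choice of parameters\<close>

text \<open>With W = c + 1 - k m the size is a concave quadratic in \<open>m\<close>. Completing the
  square reduces the claim to bounding the loss from an integral \<open>m\<close>, which the step
  from \<open>c\<close> to \<open>c + 1\<close> pays for.\<close>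

lemma hexagon_large_enough:
  fixes k n c :: nat
  assumes k: "k \<ge> 1" and c: "c \<ge> 3 * k ^ 2"
    and n: "(2 * int c + int k)\<^sup>2 \<ge> (2 * int k + 1) * (4 * int n - 1)"
  shows "\<exists>W m. m \<le> W \<and> W + k * m = c + 1 \<and> n \<le> card (hexagon W m)"
proof -
  \<comment> \<open>The vertex (2 N - k - 1) / (4 k + 2), for N = c + 1, rounded to a nearest
    integer.\<close>
  define m where "m = (2 * (c + 1) + k) div (4 * k + 2)"
  define W where "W = c + 1 - k * m"
  have m1: "(4 * k + 2) * m \<le> 2 * (c + 1) + k"
    unfolding m_def by (rule times_div_less_eq_dividend)
  have m2: "2 * (c + 1) + k < (4 * k + 2) * m + (4 * k + 2)"
    unfolding m_def by (subst add.commute, rule dividend_less_times_div) simp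
  have kc: "k \<le> c"
    using c self_le_power[OF k, of 2] by simp
  \<comment> \<open>The goal \<open>(k + 1) * m \<le> c + 1\<close> makes the subtraction in
    \<open>W\<close> exact and gives the \<open>m \<le> W\<close> needed for
    \<open>card_hexagon\<close>.\<close>
  have "(4 * k + 2) * ((k + 1) * m) \<le> (k + 1) * (2 * (c + 1) + k)"
    using mult_le_mono2[OF m1, of "k + 1"] by (simp only: mult_ac)
  also have "\<dots> \<le> (4 * k + 2) * (c + 1)"
  proof -
    have "k * (k + 1) \<le> k * (2 * (c + 1))" using kc by (intro mult_le_mono2) simp
    then show ?thesis by (simp add: algebra_simps)
  qed
  finally have "(k + 1) * m \<le> c + 1" by (simp only: mult_le_cancel1)
  then have Wm: "m \<le> W" and WN: "W + k * m = c + 1" by (auto simp: W_def)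
  let ?N = "int c + 1" and ?k = "int k" and ?m = "int m"
  \<comment> \<open>The deviation of \<open>m\<close> from the vertex, scaled by 4 k + 2; rounding
    keeps it within half that scale.\<close>
  define d where "d = 2 * (2 * ?k + 1) * ?m - (2 * ?N - ?k - 1)"
  have "int ((4 * k + 2) * m) \<le> int (2 * (c + 1) + k)" using m1 by (simp only: of_nat_le_iff)
  moreover have "int (2 * (c + 1) + k) < int ((4 * k + 2) * m + (4 * k + 2))"
    using m2 by (simp only: of_nat_less_iff)
  ultimately have "\<bar>d\<bar> \<le> 2 * ?k + 1" by (simp add: d_def algebra_simps abs_le_iff)
  then have "d\<^sup>2 \<le> (2 * ?k + 1)\<^sup>2" by (simp add: abs_le_square_iff[symmetric])
  \<comment> \<open>The right side is the growth of (2 N + k)^2 from N = c to N = c + 1;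
    \<open>c \<ge> 3 * k ^ 2\<close> makes it cover the rounding loss.\<close>
  moreover have "(2 * ?k + 1)\<^sup>2 \<le> 4 * (2 * int c + ?k) + 4"
  proof -
    have "?k \<le> ?k\<^sup>2" using k self_le_power[of ?k 2] by simp
    moreover have "int (3 * k ^ 2) \<le> int c" using c by (simp only: of_nat_le_iff)
    ultimately show ?thesis by (simp add: power2_eq_square algebra_simps)
  qed
  moreover have "4 * (2 * ?k + 1) * int (card (hexagon W m)) =
      (2 * ?N + ?k)\<^sup>2 + (2 * ?k + 1) - d\<^sup>2"
  proof -
    have W: "int W = ?N - ?k * ?m" using WN by (simp add: algebra_simps flip: of_nat_mult)
    show ?thesis
      unfolding card_hexagon[OF Wm] W d_def by (simp add: power2_eq_square algebra_simps)
  qed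
  moreover have "(2 * ?N + ?k)\<^sup>2 = (2 * int c + ?k)\<^sup>2 + 4 * (2 * int c + ?k) + 4"
    by (simp add: power2_eq_square algebra_simps)
  ultimately have "(2 * ?k + 1) * (4 * int n - 1) + (2 * ?k + 1) \<le>
      4 * (2 * ?k + 1) * int (card (hexagon W m))"
    using n by linarith
  then have "(4 * (2 * ?k + 1)) * int n \<le> (4 * (2 * ?k + 1)) * int (card (hexagon W m))"
    by (simp add: algebra_simps)
  then have "n \<le> card (hexagon W m)" by (subst (asm) mult_le_cancel_left_pos) auto
  with Wm WN show ?thesis by blast
qed

text \<open>The hypothesis on \<open>n\<close> forces r \<ge> 4 k^2, hence r - k / 2 \<ge> 3 k^2;
  squaring 2 r \<le> 2 c + k removes the root.\<close>

lemma ceiling_bound: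
  fixes k n :: nat
  defines "r \<equiv> sqrt ((2 * real k + 1) * (real n - 1 / 4))"
  assumes k: "k \<ge> 1" and n: "n \<ge> 10 * k ^ 3"
  obtains c :: nat where "\<lceil>r - real k / 2\<rceil> = int c" and "c \<ge> 3 * k ^ 2"
    and "(2 * int c + int k)\<^sup>2 \<ge> (2 * int k + 1) * (4 * int n - 1)"
proof -
  have k1: "real k \<ge> 1" using k by simp
  have nr: "real n \<ge> 10 * real k ^ 3" using n by (metis of_nat_le_iff of_nat_mult of_nat_numeral of_nat_power)
  have k3: "real k ^ 3 \<ge> 1" using k1 by simp
  have "(4 * (real k)\<^sup>2)\<^sup>2 = (2 * real k) * (8 * real k ^ 3)"
    by (simp add: power2_eq_square power3_eq_cube)
  also have "\<dots> \<le> (2 * real k + 1) * (real n - 1 / 4)"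
  proof (rule mult_mono)
    show "8 * real k ^ 3 \<le> real n - 1 / 4" using nr k3 by linarith
  qed auto
  finally have r4: "4 * (real k)\<^sup>2 \<le> r" unfolding r_def by (rule real_le_rsqrt)
  have kk: "real k \<le> (real k)\<^sup>2" using k1 by (simp add: self_le_power)
  have c0: "r - real k / 2 \<ge> 3 * (real k)\<^sup>2" using r4 kk k1 by linarith
  then have "\<lceil>r - real k / 2\<rceil> \<ge> 0"
    by (smt (verit) ceiling_le_zero zero_le_power2 le_of_int_ceiling of_int_0_le_iff)
  then obtain c where c: "\<lceil>r - real k / 2\<rceil> = int c" by (metis nonneg_int_cases)
  have cr: "real c \<ge> r - real k / 2" using le_of_int_ceiling[of "r - real k / 2"] c by simp
  have "real (3 * k ^ 2) \<le> real c" using cr c0 by simp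
  then have "3 * k ^ 2 \<le> c" by (simp only: of_nat_le_iff)
  moreover have "(2 * int k + 1) * (4 * int n - 1) \<le> (2 * int c + int k)\<^sup>2"
  proof -
    have "r \<ge> 0" using r4 by (smt (verit) zero_le_power2)
    then have "(2 * r)\<^sup>2 \<le> (2 * real c + real k)\<^sup>2" using cr by (intro power_mono) auto
    moreover have "r\<^sup>2 = (2 * real k + 1) * (real n - 1 / 4)"
      unfolding r_def using nr k3 by (subst real_sqrt_pow2) auto
    ultimately have "(2 * real k + 1) * (4 * real n - 1) \<le> (2 * real c + real k)\<^sup>2"
      by (simp add: power_mult_distrib algebra_simps)
    then have "real_of_int ((2 * int k + 1) * (4 * int n - 1)) \<le> real_of_int ((2 * int c + int k)\<^sup>2)"
      by simp
    then show ?thesis by (simp only: of_int_le_iff)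
  qed
  ultimately show ?thesis using that c by blast
qed

theorem theorem4:
  fixes k n :: nat
  assumes "k \<ge> 1" and "n \<ge> 10 * k ^ 3"
  shows "\<exists>S. generic S \<and> card S = n \<and>
    (\<forall>P \<subseteq> S. modal_path k P \<longrightarrow>
      int (card P) \<le> \<lceil>sqrt ((2 * real k + 1) * (real (card S) - 1 / 4)) - real k / 2\<rceil> + 1)"
proof -
  obtain c where c: "\<lceil>sqrt ((2 * real k + 1) * (real n - 1 / 4)) - real k / 2\<rceil> = int c"
    and c_props: "c \<ge> 3 * k ^ 2" "(2 * int c + int k)\<^sup>2 \<ge> (2 * int k + 1) * (4 * int n - 1)"
    using ceiling_bound[OF assms] by blast
  obtain W m where Wm: "W + k * m = c + 1" and "n \<le> card (hexagon W m)"
    using hexagon_large_enough[OF assms(1) c_props] by blast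
  \<comment> \<open>The hexagon may have more than \<open>n\<close> points; the length bound passes
    to any subset.\<close>
  then obtain T where T: "T \<subseteq> hexagon W m" "card T = n"
    by (meson obtain_subset_with_card_n)
  define K where "K = W + 2 * m + 1"
  have K: "W \<le> K" "2 * m < K" by (auto simp: K_def)
  define S where "S = rotate_embed K ` T"
  note inj = inj_on_rotate_embed[OF K, THEN inj_on_subset, OF T(1)]
  have "card S = n"
    using card_image[OF inj_on_imageI2[OF inj(1)]] T(2) by (simp add: S_def)
  moreover have "generic S"
    using finite_subset[OF T(1) finite_hexagon] inj[THEN inj_onD]
    unfolding generic_def S_def by simp metis
  moreover have "int (card P) \<le> int c + 1" if "P \<subseteq> S" "modal_path k P" for P
  proof -
    have "P \<subseteq> rotate_embed K ` hexagon W m" using that(1) T(1) by (auto simp: S_def)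
    from card_modal_path_le[OF this K that(2)] show ?thesis using Wm by simp
  qed
  ultimately show ?thesis using c by (intro exI[of _ S]) simp
qed

end
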